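(* Let $n,m\in\mathbb N$, let $g_0:\mathbb R^n\to\mathbb R$ and $g=(g_1,\dots,g_m):\mathbb R^n\to\mathbb R^m$ be twice continuously differentiable, let $g^L,g^U\in\mathbb R^m$, and consider the optimization problem $$(N)\qquad \min_{q_1\in\mathbb R^n} g_0(q_1)\quad\text{subject to}\quad g^L\le g(q_1)\le g^U .$$ Let $q:=(q_0,q_1,q_2,q_3,q_4,q_5)\in\mathbb R\times\mathbb R^n\times\mathbb R^m\times\mathbb R^n\times\mathbb R^m\times\mathbb R$ and $u:=(u_0,u_1,u_2)\in\mathbb R\times\mathbb R^n\times\mathbb R^m$, and let $L(q_0,q_1,q_2):=q_0\,g_0(q_1)+\langle q_2,g(q_1)\rangle$ be the generalized Lagrangian. Then all hidden algorithm primitives for Problem $(N)$ are governed by the dynamical equation $\dot q(t)=F(q(t),u(t))$, where $F$ is given by the right-hand side of $$\begin{aligned} \dot q_0(t)&=u_0(t),\\ \dot q_1(t)&=u_1(t),\\ \dot q_2(t)&=u_2(t),\\ \dot q_3(t)&=-\big[\partial^2_{q_1}L(q_0(t),q_1(t),q_2(t))\big]u_1(t)-\partial_{q_1}L(u_0(t),q_1(t),u_2(t)),\\ \dot q_4(t)&=\big[\partial_{q_1}g(q_1(t))\big]u_1(t),\\ \dot q_5(t)&=\langle\partial_{q_1}g_0(q_1(t)),u_1(t)\rangle . \end{aligned}$$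
   Context: Notation: $\partial_{q_1}$ denotes the gradient (for the vector function $g$, the $m\times n$ Jacobian matrix) and $\partial^2_{q_1}$ the Hessian with respect to $q_1$. Thus $\partial_{q_1}L(u_0,q_1,u_2)=u_0\,\partial_{q_1}g_0(q_1)+[\partial_{q_1}g(q_1)]^Tu_2$. A hidden algorithm primitive for Problem $(N)$ is a continuous-time evolution $[t_0,t_f]\ni t\mapsto q_1(t)$ (together with the associated multipliers and function values described below) from an initial state $q_1(t_0)$ (the starting point of an algorithm) to a final state $q_1(t_f)$ that is a candidate optimal point of $(N)$, i.e. satisfies the Fritz John / Karush-Kuhn-Tucker first-order necessary conditions of $(N)$. Meaning of the coordinates along a hidden algorithm primitive: $q_0(t)$ is the (Fritz John) cost multiplier, $q_1(t)$ the optimization variable, $q_2(t)$ the constraint (Karush-Kuhn-Tucker) multiplier, and, up to additive constants of motion, $q_3(t)$ is the negative gradient of the generalized Lagrangian $-\partial_{q_1}L(q_0(t),q_1(t),q_2(t))$, $q_4(t)$ is the constraint value $g(q_1(t))$, and $q_5(t)$ is the cost value $g_0(q_1(t))$. The controls $u_0(t),u_1(t),u_2(t)$ are the instantaneous rates of change of the cost multiplier, the optimization variable and the constraint multiplier, respectively. The first-order necessary condition for $(N)$ in these coordinates is $q(t_f)\in T$, where $$T:=\{q:\ q_0\ge0,\ (q_0,q_2)\neq(0,0),\ q_3=0,\ g^L\le q_4\le g^U,\ q_2\,\dag\,q_4\},$$ and $q_2\,\dag\,q_4$ means, for each $i=1,\dots,m$: $q_2^i$ is unrestricted if $g^L_i=g^U_i$;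 otherwise $q_2^i\le0$ if $q_4^i=g^L_i$, $q_2^i=0$ if $g^L_i<q_4^i<g^U_i$, and $q_2^i\ge0$ if $q_4^i=g^U_i$. *)

theory Defs
  imports "HOL-Analysis.Analysis"
begin

definition grad :: "(real ^ 'n \<Rightarrow> real) \<Rightarrow> real ^ 'n \<Rightarrow> real ^ 'n" where
  "grad f x = (\<chi> i. frechet_derivative f (at x) (axis i 1))"

definition hessian :: "(real ^ 'n \<Rightarrow> real) \<Rightarrow> real ^ 'n \<Rightarrow> real ^ 'n ^ 'n" where
  "hessian f x = jacobian (grad f) (at x)"

text \<open>Continuity of \<open>f\<close> and of \<open>grad f\<close> is implied by their differentiability.\<close>

definition twice_continuously_differentiable :: "(real ^ 'n \<Rightarrow> real) \<Rightarrow> bool" where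
  "twice_continuously_differentiable f \<longleftrightarrow>
     (\<forall>x. f differentiable (at x)) \<and>
     (\<forall>x. grad f differentiable (at x)) \<and>
     continuous_on UNIV (hessian f)"

definition lagrangian ::
  "(real ^ 'n \<Rightarrow> real) \<Rightarrow> (real ^ 'n \<Rightarrow> real ^ 'm) \<Rightarrow> real \<Rightarrow> real ^ 'n \<Rightarrow> real ^ 'm \<Rightarrow> real" where
  "lagrangian g0 g q0 q1 q2 = q0 * g0 q1 + q2 \<bullet> g q1"

abbreviation grad_lagrangian ::
  "(real ^ 'n \<Rightarrow> real) \<Rightarrow> (real ^ 'n \<Rightarrow> real ^ 'm) \<Rightarrow> real \<Rightarrow> real ^ 'n \<Rightarrow> real ^ 'm \<Rightarrow> real ^ 'n" where
  "grad_lagrangian g0 g q0 q1 q2 \<equiv> grad (\<lambda>x. lagrangian g0 g q0 x q2) q1"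

abbreviation hessian_lagrangian ::
  "(real ^ 'n \<Rightarrow> real) \<Rightarrow> (real ^ 'n \<Rightarrow> real ^ 'm) \<Rightarrow> real \<Rightarrow> real ^ 'n \<Rightarrow> real ^ 'm \<Rightarrow> real ^ 'n ^ 'n" where
  "hessian_lagrangian g0 g q0 q1 q2 \<equiv> hessian (\<lambda>x. lagrangian g0 g q0 x q2) q1"

type_synonym ('n, 'm) state =
  "real \<times> (real ^ 'n) \<times> (real ^ 'm) \<times> (real ^ 'n) \<times> (real ^ 'm) \<times> real"

type_synonym ('n, 'm) control = "real \<times> (real ^ 'n) \<times> (real ^ 'm)"

definition complementary ::
  "real ^ 'm \<Rightarrow> real ^ 'm \<Rightarrow> real ^ 'm \<Rightarrow> real ^ 'm \<Rightarrow> bool" where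
  "complementary gL gU q2 q4 \<longleftrightarrow>
     (\<forall>i. gL $ i \<noteq> gU $ i \<longrightarrow>
        (q4 $ i = gL $ i \<longrightarrow> q2 $ i \<le> 0) \<and>
        (gL $ i < q4 $ i \<and> q4 $ i < gU $ i \<longrightarrow> q2 $ i = 0) \<and>
        (q4 $ i = gU $ i \<longrightarrow> q2 $ i \<ge> 0))"

definition target_set :: "real ^ 'm \<Rightarrow> real ^ 'm \<Rightarrow> ('n::finite, 'm::finite) state set" where
  "target_set gL gU =
     {(q0, q1, q2, q3, q4, q5).
        q0 \<ge> 0 \<and> (q0, q2) \<noteq> (0, 0) \<and> q3 = 0 \<and> gL \<le> q4 \<and> q4 \<le> gU \<and>
        complementary gL gU q2 q4}"

text \<open>
  The Fritz John / Karush-Kuhn-Tucker conditions of the problem of minimizing \<open>g0\<close> subject to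
  \<open>gL \<le> g \<le> gU\<close> at the point \<open>x\<close> with cost multiplier \<open>q0\<close> and constraint multiplier \<open>q2\<close>:
  the state whose last three coordinates are the actual negative Lagrangian gradient, constraint
  value and cost value lies in the target set.
\<close>

definition fritz_john ::
  "(real ^ 'n \<Rightarrow> real) \<Rightarrow> (real ^ 'n \<Rightarrow> real ^ 'm) \<Rightarrow> real ^ 'm \<Rightarrow> real ^ 'm
    \<Rightarrow> real \<Rightarrow> real ^ 'n \<Rightarrow> real ^ 'm \<Rightarrow> bool" where
  "fritz_john g0 g gL gU q0 x q2 \<longleftrightarrow>
     (q0, x, q2, - grad_lagrangian g0 g q0 x q2, g x, g0 x) \<in> target_set gL gU"

text \<open>
  The coordinates \<open>q3\<close>, \<open>q4\<close>, \<open>q5\<close> are prescribed only up to constants of motion \<open>c3\<close>, \<open>c4\<close>, \<open>c5\<close>.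
  The terminal condition is imposed on the actual gradient and function values, so that the final
  point is a first-order candidate whatever these constants are; if they vanish, it says exactly
  that the final state lies in \<open>target_set gL gU\<close>.  Derivatives at \<open>t0\<close> and \<open>tf\<close> are one-sided.
\<close>

definition hidden_algorithm_primitive ::
  "(real ^ 'n \<Rightarrow> real) \<Rightarrow> (real ^ 'n \<Rightarrow> real ^ 'm) \<Rightarrow> real ^ 'm \<Rightarrow> real ^ 'm \<Rightarrow> real \<Rightarrow> real
    \<Rightarrow> (real \<Rightarrow> real) \<Rightarrow> (real \<Rightarrow> real ^ 'n) \<Rightarrow> (real \<Rightarrow> real ^ 'm)
    \<Rightarrow> (real \<Rightarrow> real ^ 'n) \<Rightarrow> (real \<Rightarrow> real ^ 'm) \<Rightarrow> (real \<Rightarrow> real)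
    \<Rightarrow> (real \<Rightarrow> real) \<Rightarrow> (real \<Rightarrow> real ^ 'n) \<Rightarrow> (real \<Rightarrow> real ^ 'm) \<Rightarrow> bool" where
  "hidden_algorithm_primitive g0 g gL gU t0 tf q0 q1 q2 q3 q4 q5 u0 u1 u2 \<longleftrightarrow>
     t0 < tf \<and>
     (\<forall>t\<in>{t0..tf}.
        (q0 has_vector_derivative u0 t) (at t within {t0..tf}) \<and>
        (q1 has_vector_derivative u1 t) (at t within {t0..tf}) \<and>
        (q2 has_vector_derivative u2 t) (at t within {t0..tf})) \<and>
     (\<exists>c3 c4 c5. \<forall>t\<in>{t0..tf}.
        q3 t = - grad_lagrangian g0 g (q0 t) (q1 t) (q2 t) + c3 \<and>
        q4 t = g (q1 t) + c4 \<and>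
        q5 t = g0 (q1 t) + c5) \<and>
     fritz_john g0 g gL gU (q0 tf) (q1 tf) (q2 tf)"

fun dynamics ::
  "(real ^ 'n \<Rightarrow> real) \<Rightarrow> (real ^ 'n \<Rightarrow> real ^ 'm)
    \<Rightarrow> ('n, 'm) state \<Rightarrow> ('n, 'm) control \<Rightarrow> ('n, 'm) state" where
  "dynamics g0 g (q0, q1, q2, q3, q4, q5) (u0, u1, u2) =
     (u0,
      u1,
      u2,
      - (hessian_lagrangian g0 g q0 q1 q2 *v u1) - grad_lagrangian g0 g u0 q1 u2,
      jacobian g (at q1) *v u1,
      grad g0 q1 \<bullet> u1)"

end

theory Submission
  imports Defs
begin

text \<open>Up to constants of motion, \<open>q3\<close>, \<open>q4\<close> and \<open>q5\<close>
  are functions of \<open>q0\<close>, \<open>q1\<close>, \<open>q2\<close>, whose rates are the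
  controls, so the dynamics is a total time derivative along the curve. For \<open>q4\<close> and
  \<open>q5\<close> this is the chain rule alone. For \<open>q3\<close>, the Lagrangian is linear in
  its multipliers, hence so are its gradient and Hessian in the decision variable
  (\<open>grad_lagrangian_eq\<close>, \<open>hessian_lagrangian_mult\<close>). The product rule then
  yields two groups of terms: with the multipliers frozen and the point moving, the Hessian applied
  to \<open>u1\<close>; with the point frozen, the same gradient with the multipliers replaced by
  their rates. This is \<open>has_vector_derivative_grad_lagrangian\<close>.\<close>

lemma has_derivative_grad:
  assumes "f differentiable (at x)"
  shows "(f has_derivative (\<lambda>h. grad f x \<bullet> h)) (at x)"
proof -
  let ?D = "frechet_derivative f (at x)"
  have D: "(f has_derivative ?D) (at x)"
    using assms by (rule frechet_derivative_works[THEN iffD1])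
  interpret D: linear ?D
    using D has_derivative_linear by blast
  have "?D h = grad f x \<bullet> h" for h
  proof -
    have "?D h = ?D (\<Sum>i\<in>UNIV. h $ i *s axis i 1)"
      by (simp only: basis_expansion)
    also have "\<dots> = grad f x \<bullet> h"
      by (simp add: D.sum D.scale scalar_mult_eq_scaleR grad_def inner_vec_def mult.commute)
    finally show ?thesis .
  qed
  then show ?thesis
    using D by presburger
qed

text \<open>Frechet derivatives are unique, and evaluating the functional on the axis vectors
  recovers the components of \<open>v\<close>.\<close>

lemma grad_eqI:
  assumes "(f has_derivative (\<lambda>h. v \<bullet> h)) (at x)"
  shows "grad f x = v"
proof -
  have "frechet_derivative f (at x) = (\<lambda>h. v \<bullet> h)"
    using frechet_derivative_at[OF assms] by (rule sym)
  then show ?thesis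
    by (simp add: grad_def vec_eq_iff inner_axis)
qed

lemma has_derivative_hessian:
  assumes "grad f differentiable (at x)"
  shows "(grad f has_derivative (\<lambda>h. hessian f x *v h)) (at x)"
  using assms by (simp add: hessian_def jacobian_works)

text \<open>The constraint part is expanded over the components of \<open>g\<close> because
  smoothness is assumed componentwise; this makes each multiplier a scalar coefficient, ready for
  the product rule.\<close>

lemma grad_lagrangian_eq:
  assumes "g0 differentiable (at x)" and "\<And>i. (\<lambda>y. g y $ i) differentiable (at x)"
  shows "grad_lagrangian g0 g a x b =
    a *\<^sub>R grad g0 x + (\<Sum>i\<in>UNIV. b $ i *\<^sub>R grad (\<lambda>y. g y $ i) x)"
proof (rule grad_eqI)
  have "((\<lambda>y. a *\<^sub>R g0 y + (\<Sum>i\<in>UNIV. b $ i *\<^sub>R g y $ i)) has_derivative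
      (\<lambda>h. a *\<^sub>R (grad g0 x \<bullet> h) + (\<Sum>i\<in>UNIV. b $ i *\<^sub>R (grad (\<lambda>y. g y $ i) x \<bullet> h)))) (at x)"
    by (intro has_derivative_add has_derivative_scaleR_right has_derivative_sum
        has_derivative_grad assms)
  then show "((\<lambda>y. lagrangian g0 g a y b) has_derivative
      (\<lambda>h. (a *\<^sub>R grad g0 x + (\<Sum>i\<in>UNIV. b $ i *\<^sub>R grad (\<lambda>y. g y $ i) x)) \<bullet> h)) (at x)"
    by (simp add: lagrangian_def inner_vec_def[of b] inner_add_left inner_sum_left)
qed

text \<open>Both sides, as functions of \<open>h\<close>, are derivatives at \<open>x\<close> of the
  gradient of the Lagrangian, so they agree by uniqueness.\<close>

lemma hessian_lagrangian_mult:
  assumes "twice_continuously_differentiable g0"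
    and "\<And>i. twice_continuously_differentiable (\<lambda>y. g y $ i)"
  shows "hessian_lagrangian g0 g a x b *v h =
    a *\<^sub>R (hessian g0 x *v h) + (\<Sum>i\<in>UNIV. b $ i *\<^sub>R (hessian (\<lambda>y. g y $ i) x *v h))"
    (is "?H *v h = ?R h")
proof -
  \<comment> \<open>The expansion is needed at every point, not just at \<open>x\<close>, since it
    is about to be differentiated.\<close>
  have "(\<lambda>y. grad_lagrangian g0 g a y b) =
    (\<lambda>y. a *\<^sub>R grad g0 y + (\<Sum>i\<in>UNIV. b $ i *\<^sub>R grad (\<lambda>y. g y $ i) y))"
    using assms by (auto simp: twice_continuously_differentiable_def grad_lagrangian_eq)
  moreover have "((\<lambda>y. a *\<^sub>R grad g0 y + (\<Sum>i\<in>UNIV. b $ i *\<^sub>R grad (\<lambda>y. g y $ i) y))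
      has_derivative ?R) (at x)"
    using assms
    by (intro has_derivative_add has_derivative_scaleR_right has_derivative_sum
        has_derivative_hessian) (auto simp: twice_continuously_differentiable_def)
  ultimately have R: "((\<lambda>y. grad_lagrangian g0 g a y b) has_derivative ?R) (at x)"
    by simp
  \<comment> \<open>\<open>R\<close> supplies the differentiability that makes the matrix
    \<open>?H\<close> represent the actual derivative.\<close>
  then have "((\<lambda>y. grad_lagrangian g0 g a y b) has_derivative (\<lambda>h. ?H *v h)) (at x)"
    by (intro has_derivative_hessian) (auto simp: differentiable_def)
  with R show ?thesis
    by (rule has_derivative_unique[THEN fun_cong, rotated])
qed

text \<open>Chain rule for a curve differentiated only within \<open>S\<close>: the full derivative
  of \<open>f\<close> restricts to the image of \<open>S\<close>. This covers the one-sided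
  derivatives at the endpoints.\<close>

lemma has_vector_derivative_comp:
  assumes "(q has_vector_derivative v) (at t within S)" and "(f has_derivative f') (at (q t))"
  shows "((\<lambda>s. f (q s)) has_vector_derivative f' v) (at t within S)"
  using vector_derivative_diff_chain_within[OF assms(1) has_derivative_at_withinI[OF assms(2)]]
  unfolding o_def .

lemma has_vector_derivative_grad_lagrangian:
  assumes g0: "twice_continuously_differentiable g0"
    and g: "\<And>i. twice_continuously_differentiable (\<lambda>y. g y $ i)"
    and q0: "(q0 has_vector_derivative v0) (at t within S)"
    and q1: "(q1 has_vector_derivative v1) (at t within S)"
    and q2: "(q2 has_vector_derivative v2) (at t within S)"
  shows "((\<lambda>s. grad_lagrangian g0 g (q0 s) (q1 s) (q2 s)) has_vector_derivative
    hessian_lagrangian g0 g (q0 t) (q1 t) (q2 t) *v v1 + grad_lagrangian g0 g v0 (q1 t) v2)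
    (at t within S)"
proof -
  have chain: "((\<lambda>s. grad f (q1 s)) has_vector_derivative hessian f (q1 t) *v v1) (at t within S)"
    if "twice_continuously_differentiable f" for f
    using has_vector_derivative_comp[OF q1 has_derivative_hessian] that
    by (simp add: twice_continuously_differentiable_def)
  have q2i: "((\<lambda>s. q2 s $ i) has_vector_derivative v2 $ i) (at t within S)" for i
    using bounded_linear.has_vector_derivative[OF bounded_linear_vec_nth q2] .
  \<comment> \<open>Applied with \<open>a\<close> the cost multiplier and with \<open>a\<close> each
    component of the constraint multiplier.\<close>
  have prod: "((\<lambda>s. a s *\<^sub>R grad f (q1 s)) has_vector_derivative
      a t *\<^sub>R (hessian f (q1 t) *v v1) + a' *\<^sub>R grad f (q1 t)) (at t within S)"
    if "twice_continuously_differentiable f" "(a has_vector_derivative a') (at t within S)" for f a a'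
    using has_vector_derivative_scaleR[OF _ chain[OF that(1)]] that(2)
    by (simp add: has_real_derivative_iff_has_vector_derivative)
  have "((\<lambda>s. q0 s *\<^sub>R grad g0 (q1 s) + (\<Sum>i\<in>UNIV. q2 s $ i *\<^sub>R grad (\<lambda>y. g y $ i) (q1 s)))
    has_vector_derivative
      (q0 t *\<^sub>R (hessian g0 (q1 t) *v v1) + v0 *\<^sub>R grad g0 (q1 t)) +
      (\<Sum>i\<in>UNIV. q2 t $ i *\<^sub>R (hessian (\<lambda>y. g y $ i) (q1 t) *v v1) +
        v2 $ i *\<^sub>R grad (\<lambda>y. g y $ i) (q1 t))) (at t within S)"
    by (intro has_vector_derivative_add has_vector_derivative_sum prod g0 g q0 q2i)
  \<comment> \<open>Stated for arbitrary \<open>a\<close>, \<open>b\<close> so that it rewrites the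
    gradient both at the multipliers and at their rates \<open>v0\<close>,
    \<open>v2\<close>.\<close>
  moreover have "grad_lagrangian g0 g a x b =
      a *\<^sub>R grad g0 x + (\<Sum>i\<in>UNIV. b $ i *\<^sub>R grad (\<lambda>y. g y $ i) x)" for a x b
    using g0 g by (intro grad_lagrangian_eq) (auto simp: twice_continuously_differentiable_def)
  ultimately show ?thesis
    by (simp add: hessian_lagrangian_mult[OF g0 g] sum.distrib algebra_simps)
qed

theorem theorem4p1:
  fixes g0 :: "real ^ 'n \<Rightarrow> real"
    and g :: "real ^ 'n \<Rightarrow> real ^ 'm"
    and gL gU :: "real ^ 'm"
    and t0 tf :: real
    and q0 :: "real \<Rightarrow> real" and q1 :: "real \<Rightarrow> real ^ 'n" and q2 :: "real \<Rightarrow> real ^ 'm"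
    and q3 :: "real \<Rightarrow> real ^ 'n" and q4 :: "real \<Rightarrow> real ^ 'm" and q5 :: "real \<Rightarrow> real"
    and u0 :: "real \<Rightarrow> real" and u1 :: "real \<Rightarrow> real ^ 'n" and u2 :: "real \<Rightarrow> real ^ 'm"
  assumes "twice_continuously_differentiable g0"
    and "\<And>i. twice_continuously_differentiable (\<lambda>x. g x $ i)"
    and "hidden_algorithm_primitive g0 g gL gU t0 tf q0 q1 q2 q3 q4 q5 u0 u1 u2"
  shows "\<forall>t\<in>{t0..tf}.
    ((\<lambda>s. (q0 s, q1 s, q2 s, q3 s, q4 s, q5 s)) has_vector_derivative
       dynamics g0 g (q0 t, q1 t, q2 t, q3 t, q4 t, q5 t) (u0 t, u1 t, u2 t))
     (at t within {t0..tf})"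
proof
  fix t assume t: "t \<in> {t0..tf}"
  let ?S = "{t0..tf}"
  from assms(3) t obtain c3 c4 c5 where
    d0: "(q0 has_vector_derivative u0 t) (at t within ?S)" and
    d1: "(q1 has_vector_derivative u1 t) (at t within ?S)" and
    d2: "(q2 has_vector_derivative u2 t) (at t within ?S)" and
    e3: "\<And>s. s \<in> ?S \<Longrightarrow> q3 s = - grad_lagrangian g0 g (q0 s) (q1 s) (q2 s) + c3" and
    e4: "\<And>s. s \<in> ?S \<Longrightarrow> q4 s = g (q1 s) + c4" and
    e5: "\<And>s. s \<in> ?S \<Longrightarrow> q5 s = g0 (q1 s) + c5"
    unfolding hidden_algorithm_primitive_def by blast
  have "((\<lambda>s. - grad_lagrangian g0 g (q0 s) (q1 s) (q2 s) + c3) has_vector_derivative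
      - (hessian_lagrangian g0 g (q0 t) (q1 t) (q2 t) *v u1 t + grad_lagrangian g0 g (u0 t) (q1 t) (u2 t)))
      (at t within ?S)"
    using has_vector_derivative_minus[OF has_vector_derivative_grad_lagrangian[OF assms(1,2) d0 d1 d2]]
    by (simp only: has_vector_derivative_add_const)
  \<comment> \<open>The formula for \<open>q3\<close> is known only on \<open>?S\<close>, which
    suffices because the derivative is taken within \<open>?S\<close> at a point of
    \<open>?S\<close>.\<close>
  then have d3: "(q3 has_vector_derivative
      - (hessian_lagrangian g0 g (q0 t) (q1 t) (q2 t) *v u1 t) - grad_lagrangian g0 g (u0 t) (q1 t) (u2 t))
      (at t within ?S)"
    using has_vector_derivative_transform[OF t, of q3, OF e3] by simp
  \<comment> \<open>The basis vectors of the codomain are the axis vectors, so inner products with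
    them are the components of \<open>g\<close>.\<close>
  have "g differentiable (at (q1 t))"
    using assms(2) differentiable_componentwise_within[of g "q1 t" UNIV]
    by (auto simp: twice_continuously_differentiable_def Basis_vec_def inner_axis)
  then have "(g has_derivative (\<lambda>h. jacobian g (at (q1 t)) *v h)) (at (q1 t))"
    by (simp add: jacobian_works)
  then have "((\<lambda>s. g (q1 s) + c4) has_vector_derivative jacobian g (at (q1 t)) *v u1 t) (at t within ?S)"
    by (simp add: has_vector_derivative_add_const has_vector_derivative_comp[OF d1])
  then have d4: "(q4 has_vector_derivative jacobian g (at (q1 t)) *v u1 t) (at t within ?S)"
    using has_vector_derivative_transform[OF t, of q4, OF e4] by blast
  have "((\<lambda>s. g0 (q1 s) + c5) has_vector_derivative grad g0 (q1 t) \<bullet> u1 t) (at t within ?S)"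
    using assms(1)
    by (auto simp: twice_continuously_differentiable_def has_vector_derivative_add_const
        intro!: has_vector_derivative_comp[OF d1] has_derivative_grad)
  then have d5: "(q5 has_vector_derivative grad g0 (q1 t) \<bullet> u1 t) (at t within ?S)"
    using has_vector_derivative_transform[OF t, of q5, OF e5] by blast
  show "((\<lambda>s. (q0 s, q1 s, q2 s, q3 s, q4 s, q5 s)) has_vector_derivative
       dynamics g0 g (q0 t, q1 t, q2 t, q3 t, q4 t, q5 t) (u0 t, u1 t, u2 t)) (at t within ?S)"
    using d0 d1 d2 d3 d4 d5 by (simp add: has_vector_derivative_Pair)
qed

end
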